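(* Let $q \geq 17$ be an odd prime power, let $\mathcal{C}=\mathcal{Z}(XY-Z^2)$ be the conic of $\mathrm{PG}(2,q)$ with equation $XY-Z^2=0$, and let $H=\{(1,s^4,s^2) \mid s \in \mathbb{F}_q\} \subseteq \mathcal{C}$. Let $R_0=(a_0,b_0,0)$ be a point with $a_0,b_0\in\mathbb{F}_q$ such that: if $q\equiv 1 \pmod 4$, then $a_0b_0$ is a non-square in $\mathbb{F}_q$; if $q \equiv 3 \pmod 4$, then $b_0/a_0=u^4$ for some $u\in\mathbb{F}_q\setminus\{0\}$. Then the set $K=H\cup\{R_0\}$ (of size $(q+3)/2$) is a complete arc of $\mathrm{PG}(2,q)$.
   Context: $\mathrm{PG}(2,q)$ is the projective plane over the finite field $\mathbb{F}_q$, with points written in homogeneous coordinates $(x,y,z)$. An arc is a set of points no three of which are collinear; an arc is complete if it is not contained in a strictly larger arc. *)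

theory Defs
  imports "HOL-Analysis.Analysis" "HOL-Number_Theory.Prime_Powers"
begin

text \<open>
  \<open>PG(2,q)\<close> over a finite field \<open>'a\<close> with \<open>q\<close> elements: points and lines are
  the one- and two-dimensional linear subspaces of \<open>'a ^ 3\<close>.
\<close>

definition pg_points :: "('a::field ^ 3) set set" where
  "pg_points = {P. vec.subspace P \<and> vec.dim P = 1}"

definition pg_lines :: "('a::field ^ 3) set set" where
  "pg_lines = {L. vec.subspace L \<and> vec.dim L = 2}"

text \<open>Homogeneous coordinates; this is a point only if \<open>(x, y, z) \<noteq> (0, 0, 0)\<close>.\<close>

definition pg_point :: "'a::field \<Rightarrow> 'a \<Rightarrow> 'a \<Rightarrow> ('a ^ 3) set" where
  "pg_point x y z = vec.span {vector [x, y, z]}"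

definition pg_collinear :: "('a::field ^ 3) set set \<Rightarrow> bool" where
  "pg_collinear S \<longleftrightarrow> (\<exists>L\<in>pg_lines. \<forall>P\<in>S. P \<subseteq> L)"

definition pg_arc :: "('a::field ^ 3) set set \<Rightarrow> bool" where
  "pg_arc K \<longleftrightarrow> K \<subseteq> pg_points \<and>
     (\<forall>P\<in>K. \<forall>Q\<in>K. \<forall>R\<in>K. P \<noteq> Q \<and> P \<noteq> R \<and> Q \<noteq> R \<longrightarrow> \<not> pg_collinear {P, Q, R})"

definition complete_pg_arc :: "('a::field ^ 3) set set \<Rightarrow> bool" where
  "complete_pg_arc K \<longleftrightarrow> pg_arc K \<and> \<not> (\<exists>K'. pg_arc K' \<and> K \<subset> K')"

text \<open>Zero locus of a form \<open>F\<close>: all representatives of a point have to be zeros of \<open>F\<close>.\<close>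

definition pg_zeros :: "('a::field \<Rightarrow> 'a \<Rightarrow> 'a \<Rightarrow> 'a) \<Rightarrow> ('a ^ 3) set set" where
  "pg_zeros F = {P \<in> pg_points. \<forall>v\<in>P. F (v $ 1) (v $ 2) (v $ 3) = 0}"

definition conic_C :: "('a::field ^ 3) set set" where
  "conic_C = pg_zeros (\<lambda>X Y Z. X * Y - Z\<^sup>2)"

definition set_H :: "('a::field ^ 3) set set" where
  "set_H = {pg_point 1 (s ^ 4) (s\<^sup>2) | s. True}"

end

theory Submission
  imports Defs "HOL-Library.Z2"
begin

text \<open>
  The point \<open>(x, y, z)\<close> lies on the chord of the conic through the parameters \<open>t\<close> and \<open>u\<close> iff
  \<open>y - (t + u) z + t u x = 0\<close>, and \<open>H\<close> consists of the parameters that are squares. The point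
  \<open>R\<^sub>0 = (a, b, 0)\<close> is on the chords with \<open>t u = - b / a\<close>, which is a non-square; hence \<open>K\<close> is an arc.
  For completeness the essential case is \<open>x y z \<noteq> 0\<close> with \<open>y z\<close> a non-square and \<open>x y \<noteq> z\<^sup>2\<close>: the number
  of squares \<open>t\<close> whose partner \<open>u = (t z - y) / (t x - z)\<close> is a square as well is governed by the cubic
  character sum \<open>S\<close> of \<open>t (t z - y) (t x - z)\<close>, and \<open>S > 7 - q\<close> is exactly what is needed.

  Instead of Hasse's theorem, the bound on \<open>S\<close> uses that the sums of the Legendre family
  \<open>S(c) = \<Sum>t. \<chi>(t (t - 1) (t - c))\<close> satisfy \<open>\<Sum>c\<noteq>0,1. S(c)\<^sup>2 = (q - 3) (q + 1)\<close>, where in general at least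
  three parameters \<open>c\<close> give the same value of \<open>S(c)\<^sup>2\<close>. The exceptions \<open>c\<^sup>2 - c + 1 = 0\<close> are
  dealt with by a second moment over the pencil \<open>t (t - 1) (t - c) - d\<close> instead.
\<close>

section \<open>The quadratic character\<close>

text \<open>A sum of ones in characteristic two vanishes because \<open>x\<close> and
  \<open>h x\<close> cancel.\<close>

lemma even_card_involution:
  assumes "\<And>x. x \<in> X \<Longrightarrow> h x \<in> X" "\<And>x. x \<in> X \<Longrightarrow> h (h x) = x" "\<And>x. x \<in> X \<Longrightarrow> h x \<noteq> x"
  shows "even (card X)"
proof -
  have "(\<Sum>x\<in>X. 1 :: bit) = 0"
    by (rule sum_involution_eq_0[where h = h]) (use assms in auto)
  then have "even (of_nat (card X) :: bit)"
    by (simp only: sum_constant mult_1_right dvd_0_right)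
  then show ?thesis
    by (simp only: even_of_nat_iff)
qed

text \<open>In characteristic two, translation by \<open>1\<close> would be an involution without
  fixed points.\<close>

lemma two_nonzero_if_odd_CARD:
  assumes "odd CARD('a::{field,finite})"
  shows "(2::'a) \<noteq> 0"
proof
  assume "(2::'a) = 0"
  then have "x + 1 + 1 = x" for x :: 'a
    by (metis add.assoc add.right_neutral one_add_one)
  then have "even CARD('a)"
    by (intro even_card_involution[where h = "\<lambda>x. x + 1"]) auto
  with assms show False by simp
qed

text \<open>Translation by \<open>1\<close> permutes the field, so it cannot change the sum of all
  elements.\<close>

lemma of_nat_CARD_eq_0: "of_nat CARD('a::{field,finite}) = (0::'a)"
proof -
  have "(\<Sum>x\<in>UNIV. x + 1) = (\<Sum>x\<in>UNIV. x :: 'a)"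
    by (rule sum.reindex_bij_witness[of _ "\<lambda>x. x - 1" "\<lambda>x. x + 1"]) auto
  then show ?thesis
    by (simp add: sum.distrib)
qed

lemma power_CARD_minus_1:
  fixes x :: "'a::{field,finite}"
  assumes "x \<noteq> 0"
  shows "x ^ (CARD('a) - 1) = 1"
proof -
  have "(\<Prod>y\<in>UNIV-{0}. x * y) = (\<Prod>y\<in>UNIV-{0}. y)"
    by (rule prod.reindex_bij_witness[of _ "\<lambda>y. y / x" "\<lambda>y. x * y"]) (use assms in auto)
  then show ?thesis
    by (simp add: prod.distrib)
qed

text \<open>The quadratic character, extended by \<open>0\<close> and integer valued so that
  character sums can be ordered and estimated.\<close>

definition qchar :: "'a::field \<Rightarrow> int" where
  "qchar x = (if x = 0 then 0 else if \<exists>y. x = y\<^sup>2 then 1 else -1)"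

lemma qchar_0 [simp]: "qchar 0 = 0"
  by (simp add: qchar_def)

lemma qchar_eq_0_iff [simp]: "qchar x = 0 \<longleftrightarrow> x = 0"
  by (auto simp: qchar_def)

lemma qchar_eq_1_iff: "qchar x = 1 \<longleftrightarrow> x \<noteq> 0 \<and> (\<exists>y. x = y\<^sup>2)"
  by (auto simp: qchar_def)

lemma qchar_1 [simp]: "qchar 1 = 1"
  by (metis qchar_eq_1_iff one_neq_zero power_one)

lemma qchar_cases: "qchar x = 0 \<or> qchar x = 1 \<or> qchar x = -1"
  by (auto simp: qchar_def)

lemma qchar_power2: "(qchar x)\<^sup>2 = of_bool (x \<noteq> 0)"
  by (auto simp: qchar_def)

lemma qchar_square [simp]: "x \<noteq> 0 \<Longrightarrow> qchar (x\<^sup>2) = 1"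
  by (auto simp: qchar_eq_1_iff)

text \<open>For \<open>c\<close> other than \<open>0\<close> and \<open>1\<close> this is, up to
  sign, the Frobenius trace of the Legendre curve with affine equation
  \<open>Y^2 = t (t - 1) (t - c)\<close>.\<close>

definition legendre_sum :: "'a::{field,finite} \<Rightarrow> int" where
  "legendre_sum c = (\<Sum>t\<in>UNIV. qchar (t * (t - 1) * (t - c)))"

context
  assumes two: "(2::'a::{field,finite}) \<noteq> 0"
begin

lemma neg_eq_self_iff: "- x = x \<longleftrightarrow> x = (0::'a)"
proof -
  have "- x = x \<longleftrightarrow> 2 * x = 0"
    by (metis mult_2 eq_neg_iff_add_eq_0)
  then show ?thesis using two by simp
qed

lemma card_sqrt: "int (card {y. y\<^sup>2 = (x::'a)}) = 1 + qchar x"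
proof (cases "\<exists>y. x = y\<^sup>2")
  case True
  then obtain y where "x = y\<^sup>2" by blast
  then have "{y. y\<^sup>2 = x} = {y, -y}"
    by (auto simp: power2_eq_iff)
  then show ?thesis
    using neg_eq_self_iff[of y] \<open>x = y\<^sup>2\<close> by (cases "y = 0") auto
next
  case False
  then have "{y. y\<^sup>2 = x} = {}" by auto
  then show ?thesis using False by (auto simp: qchar_def)
qed

text \<open>Double counting: each \<open>y\<close> is a square root of exactly one
  \<open>x\<close>.\<close>

lemma sum_qchar: "(\<Sum>x\<in>UNIV. qchar (x::'a)) = 0"
proof -
  have "(\<Sum>x\<in>(UNIV::'a set). int (card {y. y\<^sup>2 = x})) = int CARD('a)"
  proof -
    have "(\<Sum>x\<in>(UNIV::'a set). card {y\<in>UNIV. y\<^sup>2 = x}) = CARD('a)"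
      by (simp only: card_eq_sum) (subst sum.group, auto)
    then show ?thesis
      unfolding of_nat_sum[symmetric] by simp
  qed
  then show ?thesis
    by (simp add: card_sqrt sum.distrib)
qed

lemma card_nonzero_squares:
  "2 * card {x::'a. qchar x = 1} = CARD('a) - 1"
  "2 * card {x::'a. qchar x = -1} = CARD('a) - 1"
proof -
  let ?S = "{x::'a. qchar x = 1}" and ?N = "{x::'a. qchar x = -1}"
  have "(\<Sum>x\<in>UNIV. qchar (x::'a)) = (\<Sum>x\<in>UNIV. of_bool (x \<in> ?S) - of_bool (x \<in> ?N))"
    by (rule sum.cong) (use qchar_cases in force)+
  then have eq: "card ?S = card ?N"
    by (simp add: sum_qchar sum_subtractf)
  have "UNIV = insert 0 (?S \<union> ?N)"
    using qchar_cases by force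
  then have "CARD('a) = card (insert 0 (?S \<union> ?N))" by simp
  also have "\<dots> = Suc (card (?S \<union> ?N))"
    by (subst card_insert_disjoint) auto
  also have "card (?S \<union> ?N) = card ?S + card ?N"
    by (rule card_Un_disjoint) auto
  finally show "2 * card ?S = CARD('a) - 1" "2 * card ?N = CARD('a) - 1"
    using eq by auto
qed

lemma qchar_mult_square: "qchar x = 1 \<Longrightarrow> qchar (x * y) = qchar (y::'a)"
proof -
  assume "qchar x = 1"
  then obtain a where "x = a\<^sup>2" "a \<noteq> 0"
    by (auto simp: qchar_eq_1_iff)
  then have "(\<exists>b. x * y = b\<^sup>2) \<longleftrightarrow> (\<exists>b. y = b\<^sup>2)"
    by (metis power_mult_distrib power_divide nonzero_mult_div_cancel_left power_not_zero)
  then show ?thesis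
    using \<open>x = a\<^sup>2\<close> \<open>a \<noteq> 0\<close> by (simp add: qchar_def)
qed

text \<open>A non-square maps the squares into the non-squares, hence onto them for reasons of
  cardinality, so that it has to map the non-squares back to the squares.\<close>

lemma qchar_mult: "qchar (x * y) = qchar x * qchar (y::'a)"
proof -
  consider "x = 0 \<or> y = 0" | "qchar x = 1" | "qchar y = 1" | "qchar x = -1" "qchar y = -1"
    using qchar_cases by (metis qchar_eq_0_iff)
  then show ?thesis
  proof cases
    case 2
    then show ?thesis by (simp add: qchar_mult_square)
  next
    case 3
    then show ?thesis using qchar_mult_square[of y x] by (simp add: mult.commute)
  next
    case 4
    let ?S = "{z::'a. qchar z = 1}" and ?N = "{z::'a. qchar z = -1}"
    have "x \<noteq> 0" using 4 by auto
    have "(*) x ` ?S \<subseteq> ?N"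
      using qchar_mult_square[of _ x] 4 by (auto simp: mult.commute)
    moreover have "card ((*) x ` ?S) = card ?N"
      using card_nonzero_squares \<open>x \<noteq> 0\<close> by (subst card_image) (auto simp: inj_on_def)
    ultimately have "(*) x ` ?S = ?N"
      by (intro card_subset_eq) auto
    moreover have "x * y \<notin> (*) x ` ?S"
      using \<open>x \<noteq> 0\<close> 4 by auto
    ultimately have "x * y \<notin> ?N" by blast
    then show ?thesis
      using 4 qchar_cases[of "x * y"] by auto
  qed auto
qed

lemma qchar_mult_self: "qchar (x * x) = of_bool (x \<noteq> (0::'a))"
  by (metis qchar_mult power2_eq_square qchar_power2)

lemma qchar_inverse: "qchar (inverse x) = qchar (x::'a)"
proof (cases "x = 0")
  case False
  have "qchar (inverse x) = qchar (inverse x * (x * x))"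
    using False by (simp add: qchar_mult[of "inverse x" "x * x"] qchar_mult_self)
  also have "inverse x * (x * x) = x"
    using False by simp
  finally show ?thesis .
qed simp

lemma qchar_divide: "qchar (x / y) = qchar x * qchar (y::'a)"
  by (simp add: divide_inverse qchar_mult qchar_inverse)

lemma qchar_cube: "qchar (x ^ 3) = qchar (x::'a)"
  by (simp add: power3_eq_cube qchar_mult) (use qchar_cases[of x] in auto)

text \<open>For \<open>a \<noteq> b\<close>, the product has the same character as the quotient
  \<open>(x - a) / (x - b)\<close>, which runs through all values except \<open>1\<close>.\<close>

lemma sum_qchar_quadratic:
  "(\<Sum>x\<in>UNIV. qchar ((x - a) * (x - b))) = (if a = b then int CARD('a) else 0) - (1::int)"
  for a b :: 'a
proof (cases "a = b")
  case True
  have "(\<Sum>x\<in>UNIV. qchar ((x - a) * (x - a))) = (\<Sum>x\<in>UNIV. 1 - of_bool (x = a))"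
    by (rule sum.cong) (auto simp: qchar_mult_self)
  also have "\<dots> = int CARD('a) - 1"
    by (simp add: sum_subtractf)
  finally show ?thesis using True by simp
next
  case False
  have "(\<Sum>x\<in>UNIV. qchar ((x - a) * (x - b))) = (\<Sum>x\<in>UNIV-{b}. qchar ((x - a) * (x - b)))"
    by (simp add: sum.remove[of UNIV b])
  also have "\<dots> = (\<Sum>y\<in>UNIV-{1::'a}. qchar y)"
  proof (rule sum.reindex_bij_witness[of _ "\<lambda>y. (y * b - a) / (y - 1)" "\<lambda>x. (x - a) / (x - b)"])
    fix y :: 'a assume "y \<in> UNIV - {1}"
    then have "(y * b - a) / (y - 1) - b = (b - a) / (y - 1)"
      "(y * b - a) / (y - 1) - a = y * (b - a) / (y - 1)" "y - 1 \<noteq> 0"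
      by (auto simp: field_simps)
    then show "((y * b - a) / (y - 1) - a) / ((y * b - a) / (y - 1) - b) = y"
      "(y * b - a) / (y - 1) \<in> UNIV - {b}"
      using False by auto
  next
    fix x assume "x \<in> UNIV - {b}"
    then have x: "x - b \<noteq> 0" by auto
    then have "(x - a) / (x - b) - 1 = (b - a) / (x - b)"
      "(x - a) / (x - b) * b - a = x * (b - a) / (x - b)"
      by (auto simp: field_simps)
    then show "((x - a) / (x - b) * b - a) / ((x - a) / (x - b) - 1) = x"
      "(x - a) / (x - b) \<in> UNIV - {1}"
      using False x by auto
    show "qchar ((x - a) / (x - b)) = qchar ((x - a) * (x - b))"
      by (simp add: qchar_mult qchar_divide)
  qed
  also have "\<dots> = -1"
    using sum.remove[of UNIV 1 "qchar :: 'a \<Rightarrow> int"] sum_qchar by simp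
  finally show ?thesis using False by simp
qed

subsection \<open>Cubic character sums\<close>

text \<open>The affine substitution \<open>t = a + k w\<close> brings the roots to \<open>0\<close>,
  \<open>1\<close>, \<open>c\<close> and takes out \<open>k ^ 3\<close>, whose character is that of
  \<open>k\<close>.\<close>

lemma sum_qchar_cubic:
  "k \<noteq> 0 \<Longrightarrow> (\<Sum>t\<in>UNIV. qchar ((t - a) * (t - a - k) * (t - a - k * c))) = qchar k * legendre_sum c"
  for a c k :: 'a
proof -
  assume k: "k \<noteq> 0"
  have "(\<Sum>t\<in>UNIV. qchar ((t - a) * (t - a - k) * (t - a - k * c)))
      = (\<Sum>t\<in>UNIV. qchar (k ^ 3 * (t * (t - 1) * (t - c))))"
  proof (rule sum.reindex_bij_witness[of _ "\<lambda>t. a + k * t" "\<lambda>t. (t - a) / k"])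
    fix t
    show "a + k * ((t - a) / k) = t" "(a + k * t - a) / k = t"
      using k by simp_all
  next
    fix t
    define w where "w = (t - a) / k"
    have t: "t = a + k * w" using k by (simp add: w_def)
    have "k ^ 3 * (w * (w - 1) * (w - c)) = (t - a) * (t - a - k) * (t - a - k * c)"
      unfolding t by (simp add: power3_eq_cube algebra_simps)
    then show "qchar (k ^ 3 * ((t - a) / k * ((t - a) / k - 1) * ((t - a) / k - c)))
        = qchar ((t - a) * (t - a - k) * (t - a - k * c))"
      unfolding w_def by (rule arg_cong)
  qed auto
  then show ?thesis
    by (simp add: qchar_mult[of "k ^ 3"] qchar_cube legendre_sum_def sum_distrib_left)
qed

text \<open>The reflection at \<open>1\<close> exchanges the roots \<open>0\<close> and
  \<open>1\<close> and moves \<open>c\<close> to \<open>1 - c\<close>; squaring removes the sign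
  \<open>qchar (- 1)\<close>.\<close>

lemma legendre_sum_one_minus: "(legendre_sum (1 - c :: 'a))\<^sup>2 = (legendre_sum c)\<^sup>2"
proof -
  have "legendre_sum (1 - c) = qchar (- 1 :: 'a) * legendre_sum c"
    by (subst sum_qchar_cubic[of "-1" 1, symmetric]) (auto simp: legendre_sum_def algebra_simps)
  then show ?thesis
    by (simp add: power_mult_distrib qchar_power2)
qed

text \<open>Scaling by \<open>1 / c\<close> sends the roots \<open>0\<close>, \<open>1\<close>,
  \<open>c\<close> to \<open>0\<close>, \<open>1 / c\<close>, \<open>1\<close>.\<close>

lemma legendre_sum_inverse: "c \<noteq> (0::'a) \<Longrightarrow> (legendre_sum (1 / c))\<^sup>2 = (legendre_sum c)\<^sup>2"
proof -
  assume "c \<noteq> 0"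
  then have "legendre_sum (1 / c) = qchar (1 / c) * legendre_sum c"
    by (subst sum_qchar_cubic[of "1 / c" 0, symmetric]) (auto simp: legendre_sum_def mult_ac)
  then show ?thesis
    using \<open>c \<noteq> 0\<close> by (simp add: power_mult_distrib qchar_power2)
qed

text \<open>For \<open>c = 0\<close> the double root matters only at \<open>t = 0\<close>, which
  leaves a complete character sum minus one term. Reflection gives \<open>c = 1\<close>.\<close>

lemma legendre_sum_0_1: "(legendre_sum (0::'a))\<^sup>2 = 1" "(legendre_sum (1::'a))\<^sup>2 = 1"
proof -
  have "legendre_sum (0::'a) = (\<Sum>t\<in>UNIV. qchar (t - 1 :: 'a) - of_bool (t = 0) * qchar (- 1 :: 'a))"
    unfolding legendre_sum_def
  proof (rule sum.cong)
    fix t :: 'a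
    have "t * (t - 1) * (t - 0) = t * t * (t - 1)" by simp
    then show "qchar (t * (t - 1) * (t - 0)) = qchar (t - 1) - of_bool (t = 0) * qchar (- 1 :: 'a)"
      by (simp only: qchar_mult[of "t * t"] qchar_mult_self) auto
  qed simp
  also have "\<dots> = (\<Sum>t\<in>UNIV. qchar (t - 1 :: 'a)) - qchar (- 1 :: 'a)"
    by (simp add: sum_subtractf sum_distrib_right[symmetric])
  also have "(\<Sum>t\<in>UNIV. qchar (t - 1 :: 'a)) = (\<Sum>t\<in>UNIV. qchar (t :: 'a))"
    by (rule sum.reindex_bij_witness[of _ "\<lambda>x. x + 1" "\<lambda>x. x - 1"]) auto
  finally show "(legendre_sum (0::'a))\<^sup>2 = 1"
    by (simp add: sum_qchar qchar_power2)
  then show "(legendre_sum (1::'a))\<^sup>2 = 1"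
    using legendre_sum_one_minus[of 0] by simp
qed

text \<open>Expanding the square and summing over \<open>c\<close> first leaves quadratic sums, in
  which the diagonal \<open>t = s\<close> dominates.\<close>

lemma sum_legendre_sum_power2:
  "(\<Sum>c\<in>UNIV. (legendre_sum (c::'a))\<^sup>2) = int CARD('a) * (int CARD('a) - 2) - 1"
proof -
  let ?q = "int CARD('a)"
  define A where "A t = qchar (t * (t - 1) :: 'a)" for t
  have A: "(\<Sum>t\<in>UNIV. A t) = -1"
    using sum_qchar_quadratic[of 0 1] by (simp add: A_def)
  have A2: "(\<Sum>t\<in>UNIV. (A t)\<^sup>2) = ?q - 2"
  proof -
    have "(\<Sum>t\<in>UNIV. (A t)\<^sup>2) = (\<Sum>t\<in>UNIV. 1 - of_bool (t = 0) - of_bool (t = (1::'a)))"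
      by (rule sum.cong) (auto simp: A_def qchar_power2)
    then show ?thesis by (simp add: sum_subtractf)
  qed
  have "(\<Sum>c\<in>UNIV. (legendre_sum (c::'a))\<^sup>2)
      = (\<Sum>c\<in>UNIV. \<Sum>t\<in>UNIV. \<Sum>s\<in>UNIV. A t * A s * qchar ((c - t) * (c - s)))"
  proof (rule sum.cong)
    fix c
    have *: "qchar (t - c) * qchar (s - c) = qchar (c - t) * qchar (c - s)" for s t :: 'a
      by (metis minus_diff_eq minus_mult_minus qchar_mult)
    show "(legendre_sum c)\<^sup>2 = (\<Sum>t\<in>UNIV. \<Sum>s\<in>UNIV. A t * A s * qchar ((c - t) * (c - s)))"
      unfolding legendre_sum_def power2_eq_square sum_product A_def
      by (intro sum.cong refl) (use * in \<open>simp add: qchar_mult mult_ac\<close>)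
  qed simp
  also have "\<dots> = (\<Sum>t\<in>UNIV. \<Sum>c\<in>UNIV. \<Sum>s\<in>UNIV. A t * A s * qchar ((c - t) * (c - s)))"
    by (rule sum.swap)
  also have "\<dots> = (\<Sum>t\<in>UNIV. \<Sum>s\<in>UNIV. A t * A s * (\<Sum>c\<in>UNIV. qchar ((c - t) * (c - s))))"
    by (subst sum.swap) (simp add: sum_distrib_left)
  also have "\<dots> = (\<Sum>t\<in>UNIV. \<Sum>s\<in>UNIV. (if t = s then ?q * (A t)\<^sup>2 else 0) - A t * A s)"
    by (intro sum.cong refl) (simp only: sum_qchar_quadratic, auto simp: algebra_simps power2_eq_square)
  also have "\<dots> = ?q * (\<Sum>t\<in>UNIV. (A t)\<^sup>2) - (\<Sum>t\<in>UNIV. A t) * (\<Sum>t\<in>UNIV. A t)"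
    by (simp add: sum_subtractf sum_product) (simp add: sum_distrib_left)
  finally show ?thesis by (simp add: A A2)
qed

text \<open>The values at \<open>c\<close>, \<open>1 - c\<close> and \<open>1 / c\<close> have the same square. These are three different
  parameters unless \<open>c\<close> is one of \<open>-1, 2, 1/2\<close>, which are in turn permuted by the symmetries.\<close>

lemma legendre_sum_power2_generic:
  assumes c: "c \<noteq> (0::'a)" "c \<noteq> 1" "c\<^sup>2 - c + 1 \<noteq> 0"
  shows "3 * (legendre_sum c)\<^sup>2 \<le> (int CARD('a) - 3) * (int CARD('a) + 1)"
proof -
  let ?S = "\<lambda>c. (legendre_sum c)\<^sup>2"
  have three: "3 * ?S c \<le> (int CARD('a) - 3) * (int CARD('a) + 1)"
    if "card X = 3" "0 \<notin> X" "1 \<notin> X" "\<And>x. x \<in> X \<Longrightarrow> ?S x = ?S c" for X :: "'a set"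
  proof -
    \<comment> \<open>The \<open>2\<close> is the contribution of the degenerate parameters
      \<open>0\<close> and \<open>1\<close>.\<close>
    have "3 * ?S c + 2 = (\<Sum>x\<in>X. ?S x) + (\<Sum>x\<in>{0,1::'a}. ?S x)"
      using that by (simp add: legendre_sum_0_1)
    also have "\<dots> = (\<Sum>x\<in>X \<union> {0,1}. ?S x)"
      by (rule sum.union_disjoint[symmetric]) (use that in auto)
    also have "\<dots> \<le> (\<Sum>x\<in>(UNIV::'a set). ?S x)"
      by (rule sum_mono2) auto
    also have "\<dots> = (int CARD('a) - 3) * (int CARD('a) + 1) + 2"
      unfolding sum_legendre_sum_power2 by (simp add: algebra_simps)
    finally show ?thesis by simp
  qed
  show ?thesis
  proof (cases "c = -1 \<or> c = 2 \<or> 2 * c = 1")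
    case False
    have "c \<noteq> 1 - c" using False by (metis mult_2 diff_add_cancel)
    moreover have "c \<noteq> 1 / c"
      using False c by (metis nonzero_eq_divide_eq square_eq_1_iff)
    moreover have "1 - c \<noteq> 1 / c"
      using c by (auto simp: field_simps power2_eq_square)
    ultimately have "card {c, 1 - c, 1 / c} = 3" by auto
    then show ?thesis
      by (rule three) (use c in \<open>auto simp: legendre_sum_one_minus legendre_sum_inverse\<close>)
  next
    case True
    \<comment> \<open>In characteristic 3 the values \<open>-1\<close>, \<open>2\<close>,
      \<open>1 / 2\<close> coincide, but then they are a root of the excluded quadratic.\<close>
    have 3: "(3::'a) \<noteq> 0"
    proof
      assume "(3::'a) = 0"
      then have "c = -1"
        using True
      proof (elim disjE)
        have "(2::'a) + 1 = 3" by simp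
        then have "(2::'a) = -1"
          using \<open>(3::'a) = 0\<close> by (simp add: eq_neg_iff_add_eq_0)
        show "c = -1" if "c = 2"
          using that \<open>(2::'a) = -1\<close> by simp
        show "c = -1" if "2 * c = 1"
          using that unfolding \<open>(2::'a) = -1\<close> by (simp add: minus_equation_iff)
      qed
      then show False using c(3) \<open>(3::'a) = 0\<close> by simp
    qed
    let ?X = "{-1, 2, 1 / 2 :: 'a}"
    have "?S (-1 :: 'a) = ?S (2 :: 'a)" "?S (1 / 2 :: 'a) = ?S (2 :: 'a)"
      using legendre_sum_one_minus[of 2] legendre_sum_inverse[of 2] two by simp_all
    then have same: "?S x = ?S (2 :: 'a)" if "x \<in> ?X" for x
      using that by (elim insertE emptyE) (simp_all only:)
    have c_X: "c \<in> ?X"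
      using True two by (auto simp: field_simps)
    have card_X: "card ?X = 3"
    proof -
      have "(4::'a) = 3 + 1" by simp
      then have "(4::'a) \<noteq> 1" using 3 by (metis add_cancel_left_left)
      then have "-1 \<noteq> (2::'a)" "2 \<noteq> 1 / (2::'a)" "-1 \<noteq> 1 / (2::'a)"
        using 3 two by (auto simp: field_simps eq_neg_iff_add_eq_0)
      then show ?thesis by simp
    qed
    have "(2::'a) \<noteq> 1"
      using one_add_one[where 'a = 'a] by (metis add_cancel_left_left one_neq_zero)
    then have nX: "0 \<notin> ?X" "1 \<notin> ?X"
      using two neg_eq_self_iff[of 1] by (auto simp: field_simps)
    show ?thesis
      by (rule three[OF card_X nX]) (metis same c_X)
  qed
qed

text \<open>For a root \<open>c\<close> of \<open>c\<^sup>2 - c + 1\<close> the affine map \<open>s \<mapsto> (c - 1) s + 1\<close> permutes the roots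
  \<open>0, 1, c\<close> of \<open>f\<close> cyclically. Hence every fibre of \<open>f\<close> is an affine image of \<open>{0, 1, c}\<close>, and
  most of the sums \<open>h d\<close> below have the same square.\<close>

lemma legendre_sum_power2_special:
  assumes c: "c\<^sup>2 - c + 1 = (0::'a)"
  shows "(legendre_sum c)\<^sup>2 \<le> 6 * int CARD('a)"
proof -
  let ?q = "int CARD('a)"
  define f where "f t = t * (t - 1) * (t - c)" for t
  \<comment> \<open>The displacement of \<open>r\<close> under the affine map; it vanishes exactly
    at fixed points, where the fibre of \<open>f\<close> collapses to one element.\<close>
  define k where "k r = (c - 2) * r + 1" for r
  define h where "h d = (\<Sum>s\<in>UNIV. qchar (f s - d))" for d
  define n where "n = int (card {r. k r \<noteq> 0})"
  have f_diff: "f s - f r = (s - r) * (s - r - k r) * (s - r - k r * c)" for s r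
    using c unfolding f_def k_def by algebra
  have h_f: "(h (f r))\<^sup>2 = (legendre_sum c)\<^sup>2" if "k r \<noteq> 0" for r
    using that by (simp add: h_def f_diff sum_qchar_cubic power_mult_distrib qchar_power2)
  have fibre: "{s. f s = f r} = {r, r + k r, r + k r * c}" for r
  proof -
    have "f s = f r \<longleftrightarrow> (s - r) * (s - r - k r) * (s - r - k r * c) = 0" for s
      using f_diff[of s r] eq_iff_diff_eq_0[of "f s" "f r"] by (simp only:)
    moreover have "s - r - a = 0 \<longleftrightarrow> s = r + a" for s a
      by (auto simp: algebra_simps)
    ultimately show ?thesis by auto
  qed
  have card_fibre: "card {s. f s = f r} \<le> 1 + 2 * of_bool (k r \<noteq> 0)" for r
    unfolding fibre by (auto simp: card_insert_if)
  have card_fibre': "card {s. f s = d} \<le> 3" for d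
  proof (cases "\<exists>r. d = f r")
    case True
    then show ?thesis using card_fibre by (fastforce split: if_splits intro: order.trans)
  next
    case False
    then have "{s. f s = d} = {}" by auto
    then show ?thesis by simp
  qed
  have "(\<Sum>d\<in>UNIV. (h d)\<^sup>2) = (\<Sum>d\<in>UNIV. \<Sum>s\<in>UNIV. \<Sum>r\<in>UNIV. qchar ((d - f s) * (d - f r)))"
  proof (rule sum.cong)
    fix d
    have "(f s - d) * (f r - d) = (d - f s) * (d - f r)" for s r
      by (simp add: algebra_simps)
    then show "(h d)\<^sup>2 = (\<Sum>s\<in>UNIV. \<Sum>r\<in>UNIV. qchar ((d - f s) * (d - f r)))"
      unfolding h_def power2_eq_square sum_product by (simp add: qchar_mult[symmetric])
  qed simp
  also have "\<dots> = (\<Sum>s\<in>UNIV. \<Sum>r\<in>UNIV. \<Sum>d\<in>UNIV. qchar ((d - f s) * (d - f r)))"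
    by (subst sum.swap) (intro sum.cong refl sum.swap)
  also have "\<dots> = (\<Sum>s\<in>UNIV. \<Sum>r\<in>UNIV. (if f s = f r then ?q else 0) - 1)"
    by (simp only: sum_qchar_quadratic)
  also have "\<dots> = (\<Sum>r\<in>UNIV. ?q * int (card {s. f s = f r}) - ?q)"
    by (simp add: sum_subtractf sum.If_cases mult.commute eq_commute)
  \<comment> \<open>Subtracting \<open>?q\<close> cancels the trivial solution \<open>s = r\<close>,
    so only the \<open>n\<close> elements that are moved contribute, with at most
    \<open>2 * ?q\<close> each.\<close>
  also have "\<dots> \<le> (\<Sum>r\<in>UNIV. ?q * (1 + 2 * of_bool (k r \<noteq> 0)) - ?q)"
  proof (intro sum_mono diff_right_mono mult_left_mono)
    show "int (card {s. f s = f r}) \<le> 1 + 2 * of_bool (k r \<noteq> 0)" for r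
      using card_fibre[of r] by (auto split: if_splits)
  qed auto
  also have "\<dots> = 2 * ?q * n"
    by (simp add: n_def algebra_simps sum.distrib flip: sum_distrib_left)
  finally have moment: "(\<Sum>d\<in>UNIV. (h d)\<^sup>2) \<le> 2 * ?q * n" .
  \<comment> \<open>Conversely, each of these \<open>n\<close> elements yields the value sought, and
    summing over \<open>r\<close> meets every \<open>d\<close> at most three times.\<close>
  have "n * (legendre_sum c)\<^sup>2 = (\<Sum>r | k r \<noteq> 0. (h (f r))\<^sup>2)"
    by (simp add: n_def h_f)
  also have "\<dots> \<le> (\<Sum>r\<in>UNIV. (h (f r))\<^sup>2)"
    by (rule sum_mono2) auto
  also have "\<dots> = (\<Sum>d\<in>UNIV. \<Sum>r\<in>{r\<in>UNIV. f r = d}. (h (f r))\<^sup>2)"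
    by (rule sum.group[symmetric]) auto
  also have "\<dots> = (\<Sum>d\<in>UNIV. int (card {r. f r = d}) * (h d)\<^sup>2)"
    by simp
  also have "\<dots> \<le> (\<Sum>d\<in>UNIV. 3 * (h d)\<^sup>2)"
    by (intro sum_mono mult_right_mono) (use card_fibre' in auto)
  also have "\<dots> \<le> n * (6 * ?q)"
    using moment by (simp add: mult_ac flip: sum_distrib_left)
  finally have *: "n * (legendre_sum c)\<^sup>2 \<le> n * (6 * ?q)" .
  have "0 \<in> {r. k r \<noteq> 0}"
    by (simp add: k_def)
  then have "n > 0"
    unfolding n_def by (metis card_gt_0_iff empty_iff finite of_nat_0_less_iff)
  with * show ?thesis
    by simp
qed

text \<open>The bound \<open>6 q\<close> just fails at \<open>q = 17\<close>, since
  \<open>102 > 10^2\<close>. There \<open>c ^ 3 = -1\<close> and \<open>c ^ 16 = 1\<close> would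
  force \<open>c = -1\<close>, hence \<open>3 = 0\<close> as well as \<open>17 = 0\<close>.\<close>

lemma CARD_ne_17_if_special:
  assumes c: "c\<^sup>2 - c + 1 = (0::'a)"
  shows "CARD('a) \<noteq> 17"
proof
  assume q: "CARD('a) = 17"
  have c3: "c ^ 3 = -1" using c by algebra
  have "c \<noteq> 0" using c by auto
  then have "c ^ 16 = 1"
    using power_CARD_minus_1[of c] q by simp
  moreover have "c ^ 16 = (c ^ 3) ^ 5 * c"
    by (simp flip: power_mult power_Suc2)
  ultimately have "c = -1"
    using c3 by (simp add: minus_equation_iff)
  then have "(3::'a) = 0" using c by simp
  moreover have "(17::'a) = 0"
    using of_nat_CARD_eq_0[where 'a = 'a] q by simp
  moreover have "(1::'a) = 6 * 3 - 17" by simp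
  ultimately show False by simp
qed

lemma abs_legendre_sum_less:
  assumes q: "CARD('a) \<ge> 17" and c: "c \<noteq> (0::'a)" "c \<noteq> 1"
  shows "\<bar>legendre_sum c\<bar> < int CARD('a) - 7"
proof (rule ccontr)
  assume "\<not> ?thesis"
  then have ge: "(int CARD('a) - 7)\<^sup>2 \<le> (legendre_sum c)\<^sup>2"
    using q by (subst abs_le_square_iff[symmetric]) auto
  \<comment> \<open>With the excess over \<open>17\<close> as variable, both comparisons are between
    polynomials in \<open>n \<ge> 0\<close>, decided by their coefficients.\<close>
  define n where "n = int CARD('a) - 17"
  have n: "int CARD('a) = n + 17" "n \<ge> 0"
    using q by (auto simp: n_def)
  have "0 \<le> n * n" by simp
  show False
  proof (cases "c\<^sup>2 - c + 1 = 0")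
    case True
    then have "n \<noteq> 0"
      using CARD_ne_17_if_special n by auto
    have "(n + 10)\<^sup>2 \<le> 6 * (n + 17)"
      using ge legendre_sum_power2_special[OF True] n by (simp add: add.commute)
    then show False
      using \<open>n \<noteq> 0\<close> \<open>n \<ge> 0\<close> \<open>0 \<le> n * n\<close> by (simp add: power2_eq_square algebra_simps)
  next
    case False
    have "3 * (n + 10)\<^sup>2 \<le> (n + 14) * (n + 18)"
      using ge legendre_sum_power2_generic[OF c False] n by (simp add: add.commute)
    then show False
      using \<open>n \<ge> 0\<close> \<open>0 \<le> n * n\<close> by (simp add: power2_eq_square algebra_simps)
  qed
qed

lemma sum_qchar_cubic_lower_bound:
  assumes q: "CARD('a) \<ge> 17" and "x \<noteq> 0" "y \<noteq> 0" "z \<noteq> (0::'a)" "x * y \<noteq> z\<^sup>2"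
  shows "(\<Sum>t\<in>UNIV. qchar (t * ((t * z - y) * (t * x - z)))) > 7 - int CARD('a)"
proof -
  \<comment> \<open>The cubic has roots \<open>0\<close>, \<open>y / z\<close> and
    \<open>z / x\<close>; \<open>c\<close> is the ratio of the last two, and it differs from
    \<open>1\<close> because the point is off the conic.\<close>
  define c where "c = z\<^sup>2 / (x * y)"
  have *: "t * ((t * z - y) * (t * x - z)) = (x * z) * ((t - 0) * (t - 0 - y / z) * (t - 0 - y / z * c))" for t
    using assms by (simp add: c_def field_simps power2_eq_square)
  have "(\<Sum>t\<in>UNIV. qchar (t * ((t * z - y) * (t * x - z)))) = qchar (x * z) * (qchar (y / z) * legendre_sum c)"
    unfolding * qchar_mult[of "x * z"] sum_distrib_left[symmetric]
    by (subst sum_qchar_cubic) (use assms in auto)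
  moreover have "\<bar>legendre_sum c\<bar> < int CARD('a) - 7"
    using assms by (intro abs_legendre_sum_less) (auto simp: c_def)
  moreover have "\<bar>qchar (x * z)\<bar> = 1" "\<bar>qchar (y / z)\<bar> = 1"
    using assms by (auto simp: qchar_def)
  ultimately have "\<bar>\<Sum>t\<in>UNIV. qchar (t * ((t * z - y) * (t * x - z)))\<bar> < int CARD('a) - 7"
    by (simp add: abs_mult)
  then show ?thesis by linarith
qed

section \<open>Pairs of squares whose chord passes through a given point\<close>

lemma square_chord_generic:
  assumes q: "CARD('a) \<ge> 17" and nz: "x \<noteq> 0" "y \<noteq> 0" "z \<noteq> (0::'a)" "x * y \<noteq> z\<^sup>2"
    and yz: "qchar (y * z) = -1"
  shows "\<exists>t u. t \<noteq> u \<and> qchar t = 1 \<and> qchar u = 1 \<and> y - (t + u) * z + t * u * x = 0"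
proof -
  let ?q = "int CARD('a)"
  define g where "g t = (t * z - y) * (t * x - z)" for t
  \<comment> \<open>A product and a quotient have the same character, so these are the
    \<open>t\<close> for which \<open>t\<close> and its partner \<open>u\<close> are both nonzero
    squares.\<close>
  define N where "N = {t. qchar t = 1 \<and> qchar (g t) = 1}"
  \<comment> \<open>Parameters that are their own partner; they give tangents instead of chords and
    must be discarded.\<close>
  define F where "F = {t \<in> N. y - (t + t) * z + t * t * x = 0}"
  define \<epsilon> where "\<epsilon> = qchar (x * z)"
  have g: "g t = (x * z) * ((t - y / z) * (t - z / x))" for t
    using nz by (simp add: g_def field_simps)
  have "y / z \<noteq> z / x"
    using nz by (auto simp: field_simps power2_eq_square)
  then have sum_g: "(\<Sum>t\<in>UNIV. qchar (g t)) = - \<epsilon>"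
    unfolding g qchar_mult[of "x * z"] sum_distrib_left[symmetric]
      sum_qchar_quadratic by (simp add: \<epsilon>_def)
  have sum_tg: "(\<Sum>t\<in>UNIV. qchar (t * g t)) > 7 - ?q"
    unfolding g_def using sum_qchar_cubic_lower_bound[OF q nz] .
  have q_yz: "qchar (y / z) = -1" "qchar (z / x) = \<epsilon>"
    using yz by (simp_all add: qchar_mult qchar_divide \<epsilon>_def mult.commute)
  \<comment> \<open>Outside \<open>N\<close> only \<open>t = z / x\<close> can survive: at
    \<open>t = 0\<close> and \<open>t = y / z\<close> a factor vanishes because \<open>y z\<close>
    is a non-square.\<close>
  have terms: "(1 + qchar t) * (1 + qchar (g t)) = 4 * of_bool (t \<in> N) + (1 + \<epsilon>) * of_bool (t = z / x)" for t
  proof -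
    have "g t = 0 \<longleftrightarrow> t = y / z \<or> t = z / x"
      using nz by (auto simp: g)
    moreover have "g 0 = y * z" by (simp add: g_def)
    ultimately show ?thesis
      using qchar_cases[of t] qchar_cases[of "g t"] q_yz yz nz
      by (cases "t = z / x"; cases "t = y / z"; cases "t = 0") (auto simp: N_def)
  qed
  have "(\<Sum>t\<in>UNIV. (1 + qchar t) * (1 + qchar (g t))) = 4 * int (card N) + (1 + \<epsilon>)"
    unfolding terms by (simp add: sum.distrib flip: sum_distrib_left)
  moreover have "(\<Sum>t\<in>UNIV. (1 + qchar t) * (1 + qchar (g t)))
      = (\<Sum>t\<in>UNIV. 1 + qchar t + qchar (g t) + qchar (t * g t))"
    by (simp add: qchar_mult algebra_simps)
  \<comment> \<open>The slack \<open>7\<close> in the cubic bound is chosen for this: it yields two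
    elements of \<open>N\<close> if \<open>\<epsilon> = 1\<close> and three if
    \<open>\<epsilon> = -1\<close>, one more than \<open>F\<close> can have.\<close>
  ultimately have "4 * int (card N) > 6 - 2 * \<epsilon>"
    using sum_g sum_tg sum_qchar by (simp add: sum.distrib)
  moreover have "\<epsilon> = 1 \<or> \<epsilon> = -1"
    using nz by (auto simp: \<epsilon>_def qchar_def)
  ultimately have card_N: "\<epsilon> = 1 \<and> card N \<ge> 2 \<or> \<epsilon> = -1 \<and> card N \<ge> 3"
    by auto
  \<comment> \<open>Vieta's formulas for the quadratic defining \<open>F\<close>.\<close>
  have F: "x * (t + u) = 2 * z" "x * (t * u) = y" if "t \<in> F" "u \<in> F" "t \<noteq> u" for t u
  proof -
    have eqs: "y - (t + t) * z + t * t * x = 0" "y - (u + u) * z + u * u * x = 0"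
      using that by (auto simp: F_def)
    then have "(t - u) * (x * (t + u) - 2 * z) = 0" by algebra
    then show *: "x * (t + u) = 2 * z" using that by auto
    with eqs show "x * (t * u) = y" by algebra
  qed
  have "card F < card N"
    using card_N
  proof
    assume *: "\<epsilon> = 1 \<and> card N \<ge> 2"
    have "t = u" if "t \<in> F" "u \<in> F" for t u
    proof (rule ccontr)
      assume "t \<noteq> u"
      \<comment> \<open>If \<open>\<epsilon> = 1\<close>, then \<open>x y\<close> is a non-square,
        so the product \<open>y / x\<close> of two roots cannot be a product of squares.\<close>
      then have "qchar x * (qchar t * qchar u) = qchar y"
        using F[OF that] by (metis qchar_mult)
      moreover have "qchar t = 1" "qchar u = 1"
        using that by (auto simp: F_def N_def)
      ultimately show False
        using * yz by (auto simp: \<epsilon>_def qchar_mult)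
    qed
    then have "card F \<le> 1"
      by (simp add: card_le_Suc0_iff_eq)
    with * show ?thesis by linarith
  next
    assume *: "\<epsilon> = -1 \<and> card N \<ge> 3"
    have "card F \<le> 2"
    proof (cases "F = {}")
      case False
      then obtain t where "t \<in> F" by blast
      have "u \<in> {t, 2 * z / x - t}" if "u \<in> F" for u
        using F[OF \<open>t \<in> F\<close> that] nz by (cases "t = u") (auto simp: field_simps)
      then have "F \<subseteq> {t, 2 * z / x - t}" by blast
      from card_mono[OF _ this] have "card F \<le> card {t, 2 * z / x - t}" by simp
      also have "\<dots> \<le> 2" by (simp add: card_insert_if)
      finally show ?thesis .
    qed auto
    with * show ?thesis by linarith
  qed
  then obtain t where t: "t \<in> N" "t \<notin> F"
    by (metis card_mono finite linorder_not_less subsetI)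
  define u where "u = (t * z - y) / (t * x - z)"
  have "t * x - z \<noteq> 0"
    using t by (auto simp: N_def g_def)
  then have rel: "y - (t + u) * z + t * u * x = 0"
    by (simp add: u_def field_simps)
  moreover have "qchar t = 1" "qchar u = 1"
    using t by (simp_all add: N_def u_def g_def qchar_mult qchar_divide)
  moreover have "t \<noteq> u"
    using t rel by (auto simp: F_def)
  ultimately show ?thesis by blast
qed

text \<open>A quadratic character sum counts the solutions; there is more than one, and only
  \<open>t = c / 2\<close> is degenerate. This serves the points with \<open>x = 0\<close> or
  \<open>y = 0\<close>.\<close>

lemma sum_of_distinct_nonzero_squares:
  assumes q: "CARD('a) \<ge> 17" and c: "c \<noteq> (0::'a)"
  shows "\<exists>t u. t \<noteq> u \<and> qchar t = 1 \<and> qchar u = 1 \<and> t + u = c"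
proof -
  define N where "N = {t. qchar t = 1 \<and> qchar (c - t) = 1}"
  have terms: "(1 + qchar t) * (1 + qchar (c - t))
      = 4 * of_bool (t \<in> N) + (1 + qchar c) * of_bool (t = 0) + (1 + qchar c) * of_bool (t = c)" for t
    using qchar_cases[of t] qchar_cases[of "c - t"] c
    by (cases "t = 0"; cases "t = c") (auto simp: N_def)
  have "(\<Sum>t\<in>UNIV. (1 + qchar t) * (1 + qchar (c - t))) = 4 * int (card N) + 2 * (1 + qchar c)"
    unfolding terms by (simp add: sum.distrib flip: sum_distrib_left)
  moreover have "(\<Sum>t\<in>UNIV. (1 + qchar t) * (1 + qchar (c - t)))
      = (\<Sum>t\<in>UNIV. 1 + qchar t + qchar (c - t) + qchar (- 1 :: 'a) * qchar ((t - 0) * (t - c)))"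
  proof (rule sum.cong)
    fix t :: 'a
    have "qchar (-1 :: 'a) * qchar ((t - 0) * (t - c)) = qchar (t * (c - t))"
      unfolding qchar_mult[symmetric] by (rule arg_cong[where f = qchar]) (simp add: algebra_simps)
    then show "(1 + qchar t) * (1 + qchar (c - t))
        = 1 + qchar t + qchar (c - t) + qchar (- 1 :: 'a) * qchar ((t - 0) * (t - c))"
      by (simp only: qchar_mult) (simp add: algebra_simps)
  qed simp
  moreover have "(\<Sum>t\<in>UNIV. qchar (c - t)) = 0"
  proof -
    have "(\<Sum>t\<in>UNIV. qchar (c - t)) = (\<Sum>t\<in>UNIV. qchar (t :: 'a))"
      by (rule sum.reindex_bij_witness[of _ "\<lambda>t. c - t" "\<lambda>t. c - t"]) auto
    then show ?thesis using sum_qchar by simp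
  qed
  moreover have "(\<Sum>t\<in>UNIV. qchar (- 1 :: 'a) * qchar ((t - 0) * (t - c))) = - qchar (- 1 :: 'a)"
    unfolding sum_distrib_left[symmetric] sum_qchar_quadratic using c by simp
  ultimately have "4 * int (card N) + 2 * (1 + qchar c) = int CARD('a) - qchar (- 1 :: 'a)"
    using sum_qchar by (simp add: sum.distrib)
  then have "card N > 1"
    using q qchar_cases[of c] qchar_cases[of "-1 :: 'a"] by auto
  then have "\<not> N \<subseteq> {c / 2}"
    using card_mono[of "{c / 2}" N] by auto
  then obtain t where t: "t \<in> N" "t \<noteq> c / 2" by blast
  then have "t \<noteq> c - t"
    using two by (auto simp: field_simps)
  with t show ?thesis
    by (intro exI[of _ t] exI[of _ "c - t"]) (auto simp: N_def)
qed

text \<open>Inversion pairs up the nonzero squares other than \<open>1\<close> and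
  \<open>-1\<close>, so the parity of their number \<open>(q - 1) / 2\<close> tells whether
  \<open>-1\<close> is among them.\<close>

lemma qchar_minus_1: "qchar (- 1 :: 'a) = (if CARD('a) mod 4 = 1 then 1 else -1)"
proof -
  let ?X = "{x::'a. qchar x = 1}"
  have "even (card (?X - {1, -1}))"
  proof (rule even_card_involution[where h = inverse])
    fix x assume x: "x \<in> ?X - {1, -1}"
    then have "x \<noteq> 0" "x * x \<noteq> 1"
      by (auto simp: square_eq_1_iff)
    then show "inverse x \<noteq> x"
      by (metis right_inverse)
    then show "inverse x \<in> ?X - {1, -1}"
      using x by (auto simp: qchar_inverse inverse_eq_imp_eq)
  qed simp
  moreover have "card ?X = card (?X - {1, -1}) + card (?X \<inter> {1, -1})"
    by (metis card_Diff_subset_Int card_mono finite inf_le1 le_add_diff_inverse2)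
  moreover have "card (?X \<inter> {1, -1}) = (if qchar (- 1 :: 'a) = 1 then 2 else 1)"
  proof (cases "qchar (- 1 :: 'a) = 1")
    case True
    then have "?X \<inter> {1, -1} = {1, -1}" by auto
    then show ?thesis using True neg_eq_self_iff[of 1] by auto
  next
    case False
    then have "?X \<inter> {1, -1} = {1}" by auto
    then show ?thesis using False by auto
  qed
  ultimately have "even (card ?X) \<longleftrightarrow> qchar (- 1 :: 'a) = 1" by auto
  moreover have "2 * card ?X = CARD('a) - 1" "CARD('a) > 0"
    using card_nonzero_squares by auto
  moreover have "qchar (- 1 :: 'a) = 1 \<or> qchar (- 1 :: 'a) = -1"
    by (simp add: qchar_def)
  moreover have "even m \<longleftrightarrow> n mod 4 = 1" if "2 * m = n - 1" "n > 0" for m n :: nat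
    using that by presburger
  ultimately show ?thesis by auto
qed

end

section \<open>Chords of the conic\<close>

lemma mem_pg_point_iff: "v \<in> pg_point x y z \<longleftrightarrow> (\<exists>k. v $ 1 = k * x \<and> v $ 2 = k * y \<and> v $ 3 = k * z)"
  unfolding pg_point_def vec.span_singleton by (auto simp: vec_eq_iff forall_3 vector_3)

lemma pg_point_scale: "k \<noteq> 0 \<Longrightarrow> pg_point (k * x) (k * y) (k * z) = pg_point x y z"
proof (intro set_eqI iffI)
  fix v
  assume "v \<in> pg_point (k * x) (k * y) (k * z)"
  then show "v \<in> pg_point x y z"
    unfolding mem_pg_point_iff by (metis mult.assoc)
next
  fix v
  assume "k \<noteq> 0" "v \<in> pg_point x y z"
  then obtain m where "v $ 1 = m * x" "v $ 2 = m * y" "v $ 3 = m * z"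
    unfolding mem_pg_point_iff by blast
  with \<open>k \<noteq> 0\<close> show "v \<in> pg_point (k * x) (k * y) (k * z)"
    unfolding mem_pg_point_iff by (intro exI[of _ "m / k"]) simp
qed

lemma pg_point_in_pg_points_iff: "pg_point x y z \<in> pg_points \<longleftrightarrow> \<not> (x = 0 \<and> y = 0 \<and> z = 0)"
proof -
  have "vector [x, y, z] = (0 :: 'a ^ 3) \<longleftrightarrow> x = 0 \<and> y = 0 \<and> z = 0"
    by (simp add: vec_eq_iff forall_3 vector_3)
  then show ?thesis
    by (simp add: pg_points_def pg_point_def)
qed

lemma pg_points_cases:
  assumes "P \<in> pg_points"
  obtains x y z where "P = pg_point x y z"
proof -
  obtain B where B: "B \<subseteq> P" "vec.independent B" "P \<subseteq> vec.span B" "card B = vec.dim P"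
    by (rule vec.basis_exists)
  then obtain v where v: "B = {v}"
    using assms by (auto simp: pg_points_def card_1_singleton_iff)
  have "vec.span B \<subseteq> P"
    using assms B(1) by (intro vec.span_minimal) (auto simp: pg_points_def)
  then have "P = vec.span {v}"
    using B v by auto
  moreover have "v = vector [v $ 1, v $ 2, v $ 3]"
    by (simp add: vec_eq_iff forall_3 vector_3)
  ultimately show ?thesis
    using that unfolding pg_point_def by metis
qed

lemma pg_collinearI:
  fixes x y z x' y' z' :: "'a::field"
  assumes "\<not> (x = 0 \<and> y = 0 \<and> z = 0)" "pg_point x y z \<noteq> pg_point x' y' z'"
    and "\<not> (x' = 0 \<and> y' = 0 \<and> z' = 0)"
  shows "pg_collinear {pg_point (k * x + l * x') (k * y + l * y') (k * z + l * z'),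
    pg_point x y z, pg_point x' y' z'}"
proof -
  define p q where "p = (vector [x, y, z] :: 'a ^ 3)" and "q = (vector [x', y', z'] :: 'a ^ 3)"
  let ?L = "vec.span {p, q}"
  have nz: "p \<noteq> 0" "q \<noteq> 0"
    using assms by (auto simp: p_def q_def vec_eq_iff forall_3 vector_3)
  have "q \<notin> vec.span {p}"
  proof
    assume "q \<in> vec.span {p}"
    then obtain k where k: "q = k *s p" by (auto simp: vec.span_singleton)
    then have "k \<noteq> 0" using nz by auto
    moreover have "x' = k * x" "y' = k * y" "z' = k * z"
      using k by (simp_all add: p_def q_def vec_eq_iff forall_3 vector_3)
    ultimately show False
      using assms(2) pg_point_scale by metis
  qed
  moreover have "vec.independent {p}"
    using nz by (simp add: vec.dependent_single)
  ultimately have "vec.independent {q, p}" "q \<noteq> p"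
    using vec.independent_insertI[of q "{p}"] vec.span_base[of p "{p}"] by auto
  then have "vec.dim ?L = 2"
    by (subst vec.dim_span_eq_card_independent) (auto simp: insert_commute)
  then have "?L \<in> pg_lines"
    by (simp add: pg_lines_def)
  moreover have "vector [k * x + l * x', k * y + l * y', k * z + l * z'] = k *s p + l *s q"
    by (simp add: p_def q_def vec_eq_iff forall_3 vector_3)
  then have "pg_point (k * x + l * x') (k * y + l * y') (k * z + l * z') \<subseteq> ?L"
    unfolding pg_point_def
    by (intro vec.span_minimal) (auto intro!: vec.span_add vec.span_scale simp: vec.span_base)
  moreover have "pg_point x y z \<subseteq> ?L" "pg_point x' y' z' \<subseteq> ?L"
    unfolding pg_point_def p_def q_def by (auto intro!: vec.span_mono)
  ultimately show ?thesis
    unfolding pg_collinear_def by blast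
qed

lemma conic_point_eq_iff: "pg_point 1 (t\<^sup>2) t = pg_point 1 (u\<^sup>2) u \<longleftrightarrow> t = u"
proof
  assume *: "pg_point 1 (t\<^sup>2) t = pg_point 1 (u\<^sup>2) u"
  have "vector [1, t\<^sup>2, t] \<in> pg_point 1 (t\<^sup>2) t"
    unfolding mem_pg_point_iff by (intro exI[of _ 1]) (simp add: vector_3)
  then show "t = u"
    unfolding * mem_pg_point_iff by (auto simp: vector_3)
qed simp

lemma pg_collinear_chord:
  assumes "t \<noteq> u" "y - (t + u) * z + t * u * x = 0"
  shows "pg_collinear {pg_point x y z, pg_point 1 (t\<^sup>2) t, pg_point 1 (u\<^sup>2) u}"
proof -
  \<comment> \<open>Cramer's rule for the first and third coordinates; the chord equation then takes
    care of the second.\<close>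
  define k l where "k = (z - u * x) / (t - u)" and "l = (t * x - z) / (t - u)"
  have tu: "t - u \<noteq> 0" using assms by simp
  have kl: "k * (t - u) = z - u * x" "l * (t - u) = t * x - z"
    using tu by (simp_all add: k_def l_def)
  have "(t - u) * (k * 1 + l * 1 - x) = 0"
    using kl by algebra
  then have x: "k * 1 + l * 1 = x"
    using tu by simp
  have "(t - u) * (k * t + l * u - z) = 0"
    using kl by algebra
  then have z: "k * t + l * u = z"
    using tu by simp
  have "k * t\<^sup>2 + l * u\<^sup>2 = y"
    using assms(2) x z by algebra
  with x z pg_collinearI[of 1 "t\<^sup>2" t 1 "u\<^sup>2" u k l] assms(1) show ?thesis
    by (simp add: conic_point_eq_iff)
qed

lemma not_pg_collinear_chord:
  fixes t u :: "'a::field"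
  assumes "t \<noteq> u" "y - (t + u) * z + t * u * x \<noteq> 0"
  shows "\<not> pg_collinear {pg_point 1 (t\<^sup>2) t, pg_point 1 (u\<^sup>2) u, pg_point x y z}"
proof
  define p q r where "p = (vector [1, t\<^sup>2, t] :: 'a ^ 3)" and "q = (vector [1, u\<^sup>2, u] :: 'a ^ 3)"
    and "r = (vector [x, y, z] :: 'a ^ 3)"
  assume "pg_collinear {pg_point 1 (t\<^sup>2) t, pg_point 1 (u\<^sup>2) u, pg_point x y z}"
  then obtain L where L: "vec.dim L = 2" "{p, q, r} \<subseteq> L"
    unfolding pg_collinear_def pg_lines_def pg_point_def p_def q_def r_def
    using vec.span_base by blast
  have p: "p \<noteq> 0" by (auto simp: p_def vec_eq_iff forall_3 vector_3)
  have q: "q \<notin> vec.span {p}"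
    using assms(1) by (auto simp: vec.span_singleton p_def q_def vec_eq_iff forall_3 vector_3)
  \<comment> \<open>The plane given by the chord equation contains \<open>p\<close> and
    \<open>q\<close> but not \<open>r\<close>; so the three vectors are independent, too many for
    \<open>L\<close>.\<close>
  let ?S = "{v :: 'a ^ 3. v $ 2 - (t + u) * v $ 3 + t * u * v $ 1 = 0}"
  have "vec.span {q, p} \<subseteq> ?S"
  proof (rule vec.span_minimal)
    show "vec.subspace ?S"
    proof (rule vec.subspaceI)
      show "v + w \<in> ?S" if "v \<in> ?S" "w \<in> ?S" for v w
        using that unfolding mem_Collect_eq vector_add_component by algebra
      show "c *s v \<in> ?S" if "v \<in> ?S" for c v
        using that unfolding mem_Collect_eq vector_smult_component by algebra
    qed simp
  qed (auto simp: p_def q_def vector_3 power2_eq_square algebra_simps)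
  then have r: "r \<notin> vec.span {q, p}"
    using assms(2) by (auto simp: r_def vector_3)
  have "vec.independent {r, q, p}"
    using p q r by (intro vec.independent_insertI) (auto simp: vec.independent_empty)
  moreover have "card {r, q, p} = 3"
    using q r vec.span_base[of q "{q, p}"] vec.span_base[of p "{q, p}"] vec.span_base[of p "{p}"]
    by (subst card_3_iff) blast
  ultimately show False
    using L vec.independent_card_le_dim[of "{r, q, p}" L] by auto
qed

text \<open>Parametrizing by \<open>t = s\<^sup>2\<close> makes the points of \<open>H\<close>
  distinct for distinct parameters. The condition on \<open>qchar\<close> admits
  \<open>t = 0\<close>.\<close>

lemma set_H_eq: "set_H = (\<lambda>t::'a::{field,finite}. pg_point 1 (t\<^sup>2) t) ` {t. qchar t \<noteq> -1}"
proof -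
  have "{t::'a. qchar t \<noteq> -1} = range (\<lambda>s. s\<^sup>2)"
    by (auto simp: qchar_def)
  then show ?thesis
    by (auto simp: set_H_def image_image power2_eq_square power4_eq_xxxx mult.assoc)
qed

lemma set_H_subset_conic: "set_H \<subseteq> conic_C"
proof
  fix P :: "('a ^ 3) set" assume "P \<in> set_H"
  then obtain s where s: "P = pg_point 1 (s ^ 4) (s\<^sup>2)" by (auto simp: set_H_def)
  then have "P \<in> pg_points" by (simp add: pg_point_in_pg_points_iff)
  moreover have "v $ 1 * v $ 2 - (v $ 3)\<^sup>2 = 0" if "v \<in> P" for v
    using that unfolding s mem_pg_point_iff by (auto simp: power2_eq_square power4_eq_xxxx)
  ultimately show "P \<in> conic_C" by (simp add: conic_C_def pg_zeros_def)
qed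

section \<open>The set \<open>K\<close>: size, arc property and completeness\<close>

context
  fixes a b :: "'a::{field,finite}" and R :: "('a ^ 3) set" and K :: "('a ^ 3) set set"
  assumes two: "(2::'a) \<noteq> 0" and a: "a \<noteq> 0" and b: "b \<noteq> 0" and ab: "qchar (- b / a) = -1"
    and R: "R = pg_point a b 0" and K: "K = set_H \<union> {R}"
begin

lemma conic_point_in_K: "qchar t \<noteq> -1 \<Longrightarrow> pg_point 1 (t\<^sup>2) t \<in> K"
  by (auto simp: K set_H_eq)

lemma conic_point_ne_R: "pg_point 1 (t\<^sup>2) t \<noteq> R"
proof
  assume *: "pg_point 1 (t\<^sup>2) t = R"
  have "vector [a, b, 0] \<in> R"
    unfolding R mem_pg_point_iff by (intro exI[of _ 1]) (simp add: vector_3)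
  then show False
    using a b by (auto simp: vector_3 mem_pg_point_iff simp flip: *)
qed

lemma K_cases:
  assumes "P \<in> K"
  obtains "P = R" | t where "P = pg_point 1 (t\<^sup>2) t" "qchar t \<noteq> -1"
  using assms by (auto simp: K set_H_eq)

lemma card_K: "card K = (CARD('a) + 3) div 2"
proof -
  have "{t::'a. qchar t \<noteq> -1} = insert 0 {t. qchar t = 1}"
    using qchar_cases by fastforce
  then have "card {t::'a. qchar t \<noteq> -1} = Suc (card {t::'a. qchar t = 1})"
    by simp
  moreover have "card (set_H :: ('a ^ 3) set set) = card {t::'a. qchar t \<noteq> -1}"
    unfolding set_H_eq by (intro card_image) (auto simp: inj_on_def conic_point_eq_iff)
  moreover have "R \<notin> set_H"
    using conic_point_ne_R by (auto simp: set_H_eq)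
  then have "card K = Suc (card (set_H :: ('a ^ 3) set set))"
    by (simp add: K set_H_eq)
  ultimately have "card K = card {t::'a. qchar t = 1} + 2" by simp
  moreover have "2 * card {t::'a. qchar t = 1} = CARD('a) - 1" "CARD('a) > 0"
    using card_nonzero_squares[OF two] by auto
  ultimately show ?thesis by linarith
qed

lemma pg_arc_K: "pg_arc K"
proof -
  have HHH: "\<not> pg_collinear {pg_point 1 (t\<^sup>2) t, pg_point 1 (u\<^sup>2) u, pg_point 1 (w\<^sup>2) w}"
    if "t \<noteq> u" "t \<noteq> w" "u \<noteq> w" for t u w :: 'a
  proof (rule not_pg_collinear_chord)
    have "w\<^sup>2 - (t + u) * w + t * u * 1 = (w - t) * (w - u)"
      by (simp add: power2_eq_square algebra_simps)
    then show "w\<^sup>2 - (t + u) * w + t * u * 1 \<noteq> 0" using that by auto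
  qed fact
  have HHR: "\<not> pg_collinear {pg_point 1 (t\<^sup>2) t, pg_point 1 (u\<^sup>2) u, R}"
    if "t \<noteq> u" "qchar t \<noteq> -1" "qchar u \<noteq> -1" for t u
    unfolding R
  proof (rule not_pg_collinear_chord)
    show "b - (t + u) * 0 + t * u * a \<noteq> 0"
    proof
      assume "b - (t + u) * 0 + t * u * a = 0"
      then have "b = - (t * u * a)"
        by (simp add: eq_neg_iff_add_eq_0)
      then have "- b / a = t * u"
        using a by simp
      then have "qchar t * qchar u = -1"
        using ab by (simp add: qchar_mult[OF two])
      then show False
        using that qchar_cases[of t] qchar_cases[of u] by auto
    qed
  qed fact
  have "P \<in> pg_points" if "P \<in> K" for P
    using that by (cases rule: K_cases) (auto simp: R a pg_point_in_pg_points_iff)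
  moreover have "\<not> pg_collinear {P, Q, S}"
    if "P \<in> K" "Q \<in> K" "S \<in> K" "P \<noteq> Q" "P \<noteq> S" "Q \<noteq> S" for P Q S
    using that(1)
  proof (cases rule: K_cases)
    case 1
    with that obtain t u where "Q = pg_point 1 (t\<^sup>2) t" "qchar t \<noteq> -1"
      "S = pg_point 1 (u\<^sup>2) u" "qchar u \<noteq> -1" by (metis K_cases)
    then show ?thesis using HHR[of t u] 1 that by (auto simp: insert_commute)
  next
    case P: (2 t)
    show ?thesis using that(2)
    proof (cases rule: K_cases)
      case 1
      with that obtain u where "S = pg_point 1 (u\<^sup>2) u" "qchar u \<noteq> -1" by (metis K_cases)
      then show ?thesis using HHR[of t u] 1 P that by (auto simp: insert_commute)
    next
      case Q: (2 u)
      show ?thesis using that(3)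
      proof (cases rule: K_cases)
        case 1
        then show ?thesis using HHR[of t u] P Q that by auto
      next
        case (2 w)
        then show ?thesis using HHH[of t u w] P Q that by auto
      qed
    qed
  qed
  ultimately show ?thesis
    unfolding pg_arc_def by blast
qed

text \<open>Points on the conic or on the coordinate lines are treated directly, as are those with
  \<open>y z\<close> a nonzero square; the counting argument is for the rest.\<close>

lemma pg_collinear_secant:
  assumes q: "CARD('a) \<ge> 17" and P: "P \<in> pg_points" "P \<notin> K"
  shows "\<exists>A\<in>K. \<exists>B\<in>K. A \<noteq> B \<and> pg_collinear {P, A, B}"
proof -
  obtain x y z where xyz: "P = pg_point x y z"
    using P(1) by (rule pg_points_cases)
  have chord: ?thesis
    if "t \<noteq> u" "qchar t \<noteq> -1" "qchar u \<noteq> -1" "y - (t + u) * z + t * u * x = 0" for t u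
    using that conic_point_in_K pg_collinear_chord[of t u y z x]
    by (metis conic_point_eq_iff xyz)
  have through_R: ?thesis if "qchar t \<noteq> -1" "x = k * a + l" "y = k * b + l * t\<^sup>2" "z = l * t" for t k l
  proof -
    have "pg_collinear {P, R, pg_point 1 (t\<^sup>2) t}"
      using that pg_collinearI[of a b 0 1 "t\<^sup>2" t k l] conic_point_ne_R[of t] a
      by (simp add: xyz R)
    then show ?thesis
      using conic_point_in_K[OF that(1)] conic_point_ne_R[of t] by (metis K UnI2 singletonI)
  qed
  consider "z = 0" | "z \<noteq> 0" "x * y = z\<^sup>2" | "z \<noteq> 0" "x = 0" "y = 0" | "z \<noteq> 0" "x = 0" "y \<noteq> 0"
    | "z \<noteq> 0" "x \<noteq> 0" "y = 0" | "qchar (y * z) = 1" | "z \<noteq> 0" "x \<noteq> 0" "y \<noteq> 0" "x * y \<noteq> z\<^sup>2" "qchar (y * z) = -1"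
    using qchar_cases[of "y * z"] by fastforce
  then show ?thesis
  proof cases
    case 1
    then show ?thesis
      \<comment> \<open>The line \<open>z = 0\<close> joins \<open>R\<close> to the conic point with
        parameter \<open>0\<close>.\<close>
      using b by (intro through_R[of 0 "y / b" "x - y / b * a"]) auto
  next
    case 2
    define t where "t = z / x"
    have "x \<noteq> 0" using 2 by auto
    have "P = pg_point (x * 1) (x * t\<^sup>2) (x * t)"
    proof -
      have "x * t\<^sup>2 = y"
        using 2 \<open>x \<noteq> 0\<close> by (simp add: t_def field_simps power2_eq_square)
      then show ?thesis
        using \<open>x \<noteq> 0\<close> by (simp add: xyz t_def)
    qed
    then have Pt: "P = pg_point 1 (t\<^sup>2) t"
      using pg_point_scale[of x 1 "t\<^sup>2" t] \<open>x \<noteq> 0\<close> by simp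
    then have t: "qchar t = -1"
      using P(2) conic_point_in_K by blast
    then have "t \<noteq> 0" by auto
    \<comment> \<open>The second intersection of the conic with the line through \<open>P\<close>
      and \<open>R\<close>; as a quotient of two non-squares it is a square.\<close>
    define u where "u = - b / a / t"
    have u: "qchar u = 1"
      unfolding u_def qchar_divide[OF two, of _ t] ab t by simp
    have "b - (t + u) * 0 + t * u * a = 0"
      using \<open>t \<noteq> 0\<close> a by (simp add: u_def)
    then have "pg_collinear {R, P, pg_point 1 (u\<^sup>2) u}"
      unfolding R Pt using t u by (intro pg_collinear_chord) auto
    then have "pg_collinear {P, R, pg_point 1 (u\<^sup>2) u}"
      by (simp add: insert_commute)
    then show ?thesis
      using conic_point_in_K[of u] conic_point_ne_R[of u] u by (metis K UnI2 singletonI one_neq_neg_one)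
  next
    case 3
    show ?thesis
    proof (cases "qchar (- 1 :: 'a) = 1")
      case True
      then show ?thesis
        \<comment> \<open>Chords through \<open>(0, 0, 1)\<close> join opposite parameters.\<close>
        using 3 neg_eq_self_iff[OF two, of 1] by (intro chord[of 1 "-1"]) auto
    next
      case False
      then have "qchar (- 1 :: 'a) = -1"
        using qchar_cases[of "-1 :: 'a"] by simp
      moreover have "b / a = - 1 * (- b / a)" by simp
      ultimately have "qchar (b / a) = 1"
        using ab by (simp only: qchar_mult[OF two])
      then obtain s where s: "b / a = s\<^sup>2"
        using qchar_eq_1_iff by blast
      then have "s \<noteq> 0" using a b by auto
      have "qchar (- s) = - qchar s"
        using \<open>qchar (- 1 :: 'a) = -1\<close> qchar_mult[OF two, of "-1" s] by simp
      \<comment> \<open>As \<open>-1\<close> is a non-square, one of \<open>s\<close> and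
        \<open>-s\<close> is a square. The point with that parameter agrees with \<open>R\<close> in
        the ratio of the first two coordinates, so the line joining them contains
        \<open>(0, 0, 1)\<close>.\<close>
      then obtain t where t: "t\<^sup>2 = b / a" "t \<noteq> 0" "qchar t = 1"
        using s \<open>s \<noteq> 0\<close> qchar_cases[of s] by (metis add.inverse_inverse neg_equal_0_iff_equal power2_minus qchar_eq_0_iff)
      then show ?thesis
        using 3 a by (intro through_R[of t "- (z / t) / a" "z / t"]) auto
    qed
  next
    case 4
    then obtain t u where "t \<noteq> u" "qchar t = 1" "qchar u = 1" "t + u = y / z"
      using sum_of_distinct_nonzero_squares[OF two q, of "y / z"] by auto
    then show ?thesis
      using 4 by (intro chord[of t u]) auto
  next
    case 5
    then obtain t u where tu: "t \<noteq> u" "qchar t = 1" "qchar u = 1" "t + u = x / z"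
      using sum_of_distinct_nonzero_squares[OF two q, of "x / z"] by auto
    then have "t \<noteq> 0" "u \<noteq> 0" by auto
    moreover have "x = (t + u) * z"
      using tu 5 by simp
    ultimately show ?thesis
      \<comment> \<open>For \<open>y = 0\<close> the chord equation prescribes the sum of the
        inverse parameters.\<close>
      using tu 5 by (intro chord[of "1 / t" "1 / u"]) (auto simp: qchar_divide[OF two] field_simps)
  next
    case 6
    then have "y \<noteq> 0" "z \<noteq> 0" "qchar (y / z) = 1"
      by (auto simp: qchar_mult[OF two] qchar_divide[OF two])
    then show ?thesis
      \<comment> \<open>The partner of the parameter \<open>0\<close> is \<open>y / z\<close>, here
        a square.\<close>
      by (intro chord[of 0 "y / z"]) auto
  next
    case 7
    then show ?thesis
      using square_chord_generic[OF two q, of x y z] chord by fastforce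
  qed
qed

lemma complete_pg_arc_K:
  assumes q: "CARD('a) \<ge> 17"
  shows "complete_pg_arc K"
  unfolding complete_pg_arc_def
proof (intro conjI notI pg_arc_K)
  assume "\<exists>K'. pg_arc K' \<and> K \<subset> K'"
  then obtain K' P where K': "pg_arc K'" "K \<subset> K'" "P \<in> K'" "P \<notin> K" by blast
  then obtain A B where AB: "A \<in> K" "B \<in> K" "A \<noteq> B" "pg_collinear {P, A, B}"
    using pg_collinear_secant[OF q, of P] unfolding pg_arc_def by blast
  then have "A \<in> K'" "B \<in> K'" "P \<noteq> A" "P \<noteq> B"
    using K' by auto
  then show False
    using K'(1,3) AB(3,4) by (simp add: pg_arc_def)
qed

end

theorem theorem3p8:
  fixes q :: nat and a0 b0 :: "'a::{field,finite}"
    and R0 :: "('a ^ 3) set" and K :: "('a ^ 3) set set"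
  assumes "primepow q" and "odd q" and "q \<ge> 17"
    and "CARD('a) = q"
    and "R0 = pg_point a0 b0 0" and "R0 \<in> pg_points"
    and "q mod 4 = 1 \<Longrightarrow> \<not> (\<exists>c. a0 * b0 = c\<^sup>2)"
    and "q mod 4 = 3 \<Longrightarrow> a0 \<noteq> 0 \<and> (\<exists>u. u \<noteq> 0 \<and> b0 / a0 = u ^ 4)"
    and "K = set_H \<union> {R0}"
  shows "(set_H :: ('a ^ 3) set set) \<subseteq> conic_C \<and> card K = (q + 3) div 2 \<and> complete_pg_arc K"
proof -
  have two: "(2::'a) \<noteq> 0"
    using two_nonzero_if_odd_CARD assms by blast
  have neg: "qchar (- b0 / a0) = qchar (- 1 :: 'a) * qchar (b0 / a0)"
    unfolding qchar_mult[OF two, symmetric] by simp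
  \<comment> \<open>Both congruence classes lead to the same condition: \<open>-1\<close> is a
    square in the first and a non-square in the second, while \<open>b0 / a0\<close> is a non-square
    in the first and a square in the second.\<close>
  have "a0 \<noteq> 0 \<and> b0 \<noteq> 0 \<and> qchar (- b0 / a0) = -1"
  proof (cases "q mod 4 = 1")
    case True
    then have *: "\<not> (\<exists>c. a0 * b0 = c\<^sup>2)" using assms by blast
    then have nz: "a0 \<noteq> 0" "b0 \<noteq> 0" by (metis mult_zero_left mult_zero_right zero_power2)+
    then have "qchar (a0 * b0) = -1"
      using * by (simp add: qchar_def)
    moreover have "qchar (b0 / a0) = qchar (a0 * b0)"
      by (simp add: qchar_mult[OF two] qchar_divide[OF two])
    ultimately show ?thesis
      using nz True assms(4) unfolding neg by (simp add: qchar_minus_1[OF two])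
  next
    case False
    then have "q mod 4 = 3" using \<open>odd q\<close> by presburger
    then obtain u where u: "a0 \<noteq> 0" "u \<noteq> 0" "b0 / a0 = u ^ 4" using assms by blast
    have "qchar (u ^ 4) = 1"
      using u qchar_square[of "u\<^sup>2"] by (simp flip: power_mult)
    then show ?thesis
      using u False assms(4) unfolding neg by (auto simp: qchar_minus_1[OF two])
  qed
  then have "card K = (CARD('a) + 3) div 2" "complete_pg_arc K"
    using card_K[OF two, of a0 b0 R0 K] complete_pg_arc_K[OF two, of a0 b0 R0 K] assms(3,4,5,9) by simp_all
  then show ?thesis
    using set_H_subset_conic assms(4) by simp
qed

end
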